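(* For $\phi \in (0,\pi)$ and every $\lambda >1$, define $$k_\lambda=\frac{\ln \lambda}{2\pi}+\frac{\lambda -1}{\sqrt{2\lambda(1-\cos\phi) }}\left(1-\frac{\phi}{2\pi}\right).$$ Then the problem $\mathcal W_\phi\text{-MSP}_1(1)$ (searching the conic complement of angle $\phi$ with one unit-speed agent) admits a solution with search cost $\mathcal R_\phi$, where $\mathcal R_\phi$ is the minimum of the function $$\lambda\mapsto\frac{\sqrt{\lambda ^2-2 \lambda \cos \phi+1}}{\lambda -1}\,e^{2\pi k_\lambda}$$ over the interval $\lambda \in (1,\infty)$. Moreover, for every $\phi \in (0,\pi)$ this value $\mathcal R_\phi$ is strictly smaller than $\mathcal U_1$.
   Context: $\mathcal U_1=\frac{\sqrt{1+\kappa_1^2}}{\kappa_1}e^{2\pi\kappa_1}\approx 17.28935$, where $\kappa_1$ is the unique positive root of $k^3+k=\frac1{2\pi}$. Polar notation: $\langle \rho,\chi\rangle = \rho(\cos\chi,\sin\chi)$. Ray $\mathcal L_\psi=\{\langle x,\psi\rangle:x>0\}$. Cone $\mathcal C_\phi=\bigcup_{\psi\in[0,\phi)}\mathcal L_\psi$; conic complement $\mathcal W_\phi=(\mathbb R^2\setminus\{(0,0)\})\setminus\mathcal C_\phi$. A point $P=\langle x,\psi\rangle$ exposes $A=\langle y,\psi\rangle$ (with $x,y>0$, same ray from the origin) if $x\ge y$. Problem $\mathcal D\text{-MSP}_1(1)$, for a search domain $\mathcal D\subseteq\mathbb R^2\setminus\{(0,0)\}$: a feasible solution is a continuous, piecewise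 differentiable curve $\tau:\mathbb R\to\mathbb R^2$ with $\lim_{t\to-\infty}\tau(t)=(0,0)$ such that every $A\in\mathcal D$ is exposed by some point $\tau(t)$. The parameter $t$ is not physical time: the unit-speed agent reaches $\tau(t)$ at time $\ell(t)=\int_{-\infty}^t\|\tau'(u)\|\,du$. If $t_A$ is the earliest parameter at which $\tau(t_A)$ exposes $A$, the search cost of the solution is $\sup_{A\in\mathcal D}\ell(t_A)/\|A\|$. "Admits a solution with search cost $S$" means there is a feasible solution whose search cost equals $S$. *)

theory Defs
  imports "HOL-Analysis.Analysis"
begin

type_synonym plane = "real \<times> real"

definition polar :: "real \<Rightarrow> real \<Rightarrow> plane" where
  "polar \<rho> \<theta> = (\<rho> * cos \<theta>, \<rho> * sin \<theta>)"

definition ray :: "real \<Rightarrow> plane set" where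
  "ray \<psi> = {polar x \<psi> | x. x > 0}"

definition cone_dom :: "real \<Rightarrow> plane set" where
  "cone_dom \<phi> = (\<Union>\<psi>\<in>{0..<\<phi>}. ray \<psi>)"

definition conic_complement :: "real \<Rightarrow> plane set" where
  "conic_complement \<phi> = (UNIV - {(0, 0)}) - cone_dom \<phi>"

definition exposes :: "plane \<Rightarrow> plane \<Rightarrow> bool" where
  "exposes P A \<longleftrightarrow>
     (\<exists>x y \<psi>. x > 0 \<and> y > 0 \<and> P = polar x \<psi> \<and> A = polar y \<psi> \<and> x \<ge> y)"

text \<open>
  A curve on the whole real line is piecewise differentiable if it has finitely many
  breakpoints in every compact interval; infinitely many breakpoints may occur as the
  parameter tends to either end.  The library predicate by itself asks for a finite set
  of breakpoints, hence the quantification over compact intervals.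
\<close>

definition feasible :: "plane set \<Rightarrow> (real \<Rightarrow> plane) \<Rightarrow> bool" where
  "feasible D \<tau> \<longleftrightarrow>
     continuous_on UNIV \<tau> \<and>
     (\<forall>a b. \<tau> piecewise_differentiable_on {a..b}) \<and>
     (\<tau> \<longlongrightarrow> (0, 0)) at_bot \<and>
     (\<forall>A\<in>D. \<exists>t. exposes (\<tau> t) A)"

text \<open>
  Travelled length up to a parameter, as an extended value since nothing in the notion of
  feasibility excludes infinite length.  The breakpoints form a null set, so
  the unspecified value of the derivative there is irrelevant.
\<close>

definition travel_time :: "(real \<Rightarrow> plane) \<Rightarrow> real \<Rightarrow> ennreal" where
  "travel_time \<tau> t =
     (\<integral>\<^sup>+u\<in>{..t}. ennreal (norm (vector_derivative \<tau> (at u))) \<partial>lborel)"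

text \<open>
  For feasible curves and points of the search domain the least element exists: the set of
  exposing parameters is nonempty, closed by continuity, and bounded below because the curve
  tends to the origin at minus infinity.
\<close>

definition exposure_param :: "(real \<Rightarrow> plane) \<Rightarrow> plane \<Rightarrow> real" where
  "exposure_param \<tau> A = (LEAST t. exposes (\<tau> t) A)"

definition search_cost :: "plane set \<Rightarrow> (real \<Rightarrow> plane) \<Rightarrow> ennreal" where
  "search_cost D \<tau> = (SUP A\<in>D. travel_time \<tau> (exposure_param \<tau> A) / ennreal (norm A))"

definition admits_solution_with_cost :: "plane set \<Rightarrow> real \<Rightarrow> bool" where
  "admits_solution_with_cost D S \<longleftrightarrow> S \<ge> 0 \<and>
     (\<exists>\<tau>. feasible D \<tau> \<and> search_cost D \<tau> = ennreal S)"

definition kappa1 :: real where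
  "kappa1 = (THE k. k > 0 \<and> k ^ 3 + k = 1 / (2 * pi))"

definition U1 :: real where
  "U1 = sqrt (1 + kappa1\<^sup>2) / kappa1 * exp (2 * pi * kappa1)"

definition k_exp :: "real \<Rightarrow> real \<Rightarrow> real" where
  "k_exp \<phi> l =
     ln l / (2 * pi) + (l - 1) / sqrt (2 * l * (1 - cos \<phi>)) * (1 - \<phi> / (2 * pi))"

definition cost_fun :: "real \<Rightarrow> real \<Rightarrow> real" where
  "cost_fun \<phi> l =
     sqrt (l\<^sup>2 - 2 * l * cos \<phi> + 1) / (l - 1) * exp (2 * pi * k_exp \<phi> l)"

definition is_minimum_on :: "(real \<Rightarrow> real) \<Rightarrow> real set \<Rightarrow> real \<Rightarrow> bool" where
  "is_minimum_on f I m \<longleftrightarrow> m \<in> f ` I \<and> (\<forall>x\<in>I. m \<le> f x)"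

end

theory Submission
  imports Defs "HOL-Real_Asymp.Real_Asymp"
begin

text \<open>
  The agent follows a curve that is self-similar under one full turn. Over the cone it
  moves along the chord from \<open>polar 1 0\<close> to \<open>polar l \<phi>\<close>, over the remaining angles
  along a logarithmic spiral. The slope of the spiral is chosen such that the travelled length is
  the same multiple of the distance to the origin at every point outside the open cone; hence the
  search cost is this multiple times the growth factor of one turn. For the bound by \<open>U1\<close>, a suitable
  \<open>l\<close> gives the spiral the slope \<open>kappa1\<close> of the optimal spiral for the whole plane, while the
  chord makes the growth per turn smaller, because \<open>arsinh (kappa1 * sin (\<phi> / 2)) < kappa1 * \<phi> / 2\<close>.
\<close>

section \<open>Functions that are multiplied by a fixed factor under a period shift\<close>

text \<open>The values of \<open>h\<close> on \<open>[0, T)\<close> are continued so that shifting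
  \<open>t\<close> by \<open>T\<close> multiplies by \<open>q\<close>. The exponent is an integer
  power because cells left of 0 need negative ones.\<close>

definition geo_ext :: "real \<Rightarrow> real \<Rightarrow> (real \<Rightarrow> 'a::real_normed_vector) \<Rightarrow> real \<Rightarrow> 'a" where
  "geo_ext T q h t = (q powi \<lfloor>t / T\<rfloor>) *\<^sub>R h (t - T * \<lfloor>t / T\<rfloor>)"

lemma geo_ext_eq_less:
  assumes "T > 0" "T * of_int n \<le> t" "t < T * (of_int n + 1)"
  shows "geo_ext T q h t = (q powi n) *\<^sub>R h (t - T * of_int n)"
proof -
  have "\<lfloor>t / T\<rfloor> = n"
    using assms by (intro floor_unique) (auto simp: field_simps)
  then show ?thesis by (simp add: geo_ext_def)
qed

text \<open>The matching condition on \<open>h T\<close> and \<open>h 0\<close> makes the formulas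
  of adjacent cells agree at their common endpoint, so closed cells can be glued.\<close>

lemma geo_ext_eq:
  assumes "T > 0" "q > 0" "h T = q *\<^sub>R h 0" "T * of_int n \<le> t" "t \<le> T * (of_int n + 1)"
  shows "geo_ext T q h t = (q powi n) *\<^sub>R h (t - T * of_int n)"
proof (cases "t = T * (of_int n + 1)")
  case True
  have "geo_ext T q h t = (q powi (n + 1)) *\<^sub>R h (t - T * of_int (n + 1))"
    using assms True by (intro geo_ext_eq_less) auto
  also have "\<dots> = (q powi n) *\<^sub>R h (t - T * of_int n)"
    using True assms by (simp add: power_int_add algebra_simps)
  finally show ?thesis .
next
  case False
  then show ?thesis using assms by (intro geo_ext_eq_less) auto
qed

lemma floor_period:
  fixes T t :: real
  assumes "T > 0"
  shows "T * of_int \<lfloor>t / T\<rfloor> \<le> t" "t < T * (of_int \<lfloor>t / T\<rfloor> + 1)"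
  using assms by (metis mult.commute of_int_floor_le pos_le_divide_eq)
    (use assms in \<open>metis mult.commute floor_correct of_int_1 of_int_add pos_divide_less_eq\<close>)

lemma continuous_geo_ext:
  assumes "T > 0" "q > 0" "h T = q *\<^sub>R h 0" "continuous_on {0..T} h"
  shows "continuous_on UNIV (geo_ext T q h)"
proof -
  have cell: "continuous_on {T * of_int n..T * (of_int n + 1)} (geo_ext T q h)" for n
  proof -
    have "continuous_on {T * of_int n..T * (of_int n + 1)} (\<lambda>t. (q powi n) *\<^sub>R h (t - T * of_int n))"
      by (intro continuous_intros continuous_on_compose2[OF assms(4)]) (auto simp: algebra_simps)
    then show ?thesis
      using assms by (subst continuous_on_cong[OF refl geo_ext_eq]) auto
  qed
  have "isCont (geo_ext T q h) t" for t
  proof -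
    obtain n where n: "T * of_int n \<le> t" "t < T * (of_int n + 1)"
      using floor_period[OF assms(1)] by blast
    \<comment> \<open>If \<open>t\<close> is the left end of its cell, it becomes an interior point
      only after the previous cell is joined.\<close>
    have "continuous_on ({T * of_int (n - 1)..T * (of_int (n - 1) + 1)} \<union> {T * of_int n..T * (of_int n + 1)})
        (geo_ext T q h)"
      by (intro continuous_on_closed_Un cell) auto
    moreover have "{T * of_int (n - 1)..T * (of_int (n - 1) + 1)} \<union> {T * of_int n..T * (of_int n + 1)}
        = {T * (of_int n - 1)..T * (of_int n + 1)}"
      using assms(1) by (auto simp: algebra_simps)
    ultimately have "continuous_on {T * (of_int n - 1)..T * (of_int n + 1)} (geo_ext T q h)" by simp
    moreover have "T * (of_int n - 1) < t" using n assms(1) by (simp add: algebra_simps)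
    ultimately show ?thesis
      using n by (auto intro!: continuous_on_interior)
  qed
  then show ?thesis by (simp add: continuous_at_imp_continuous_on)
qed

text \<open>On one period \<open>h\<close> is bounded by compactness, and the scaling factor is at
  most \<open>q powr (t / T)\<close>, which decays at minus infinity because
  \<open>q > 1\<close>.\<close>

lemma geo_ext_tendsto_0:
  assumes "T > 0" "q > 1" "continuous_on {0..T} h"
  shows "(geo_ext T q h \<longlongrightarrow> 0) at_bot"
proof -
  have "bounded (h ` {0..T})"
    using assms by (intro compact_imp_bounded compact_continuous_image) auto
  then obtain B where B: "\<And>s. s \<in> {0..T} \<Longrightarrow> norm (h s) \<le> B" "B > 0"
    unfolding bounded_pos by (metis imageI)
  have bound: "norm (geo_ext T q h t) \<le> q powr (t / T) * B" for t
  proof -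
    have "t - T * \<lfloor>t / T\<rfloor> \<in> {0..T}"
      using floor_period[OF assms(1), of t] by (auto simp: algebra_simps)
    then have "norm (h (t - T * \<lfloor>t / T\<rfloor>)) \<le> B" by (rule B)
    moreover have "q powi \<lfloor>t / T\<rfloor> \<le> q powr (t / T)"
      using assms(2) by (simp flip: powr_real_of_int')
    ultimately show ?thesis
      using assms(2) by (auto simp: geo_ext_def intro!: mult_mono)
  qed
  have "((\<lambda>t. q powr (t / T) * B) \<longlongrightarrow> 0) at_bot"
  proof -
    have "LIM t at_bot. (ln q / T) * t :> at_bot"
      using assms by (intro filterlim_tendsto_pos_mult_at_bot[OF tendsto_const]) (auto simp: filterlim_ident)
    then have "((\<lambda>t. exp ((ln q / T) * t)) \<longlongrightarrow> 0) at_bot"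
      by (rule filterlim_compose[OF exp_at_bot])
    then have "((\<lambda>t. q powr (t / T)) \<longlongrightarrow> 0) at_bot"
      using assms by (simp add: powr_def mult.commute)
    then show ?thesis by (rule tendsto_mult_left_zero)
  qed
  then show ?thesis
    by (rule Lim_null_comparison[rotated]) (simp add: bound)
qed

lemma has_vector_derivative_geo_ext:
  assumes "T > 0" "(h has_vector_derivative h') (at s)" "0 < s" "s < T"
  shows "(geo_ext T q h has_vector_derivative (q powi n) *\<^sub>R h') (at (T * of_int n + s))"
proof -
  have "((\<lambda>t. (q powi n) *\<^sub>R h (t - T * of_int n)) has_vector_derivative (q powi n) *\<^sub>R h') (at (T * of_int n + s))"
    using assms by (auto intro!: derivative_eq_intros vector_diff_chain_at[of "\<lambda>t. t - T * of_int n" 1 _ h, unfolded o_def, simplified])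
  moreover have "T * of_int n + s \<in> {T * of_int n<..<T * (of_int n + 1)}"
    using assms by (auto simp: algebra_simps)
  ultimately show ?thesis
    using assms(1)
    by (elim has_vector_derivative_transform_within_open[OF _ open_greaterThanLessThan[of "T * of_int n" "T * (of_int n + 1)"]])
       (auto simp: geo_ext_eq_less[where n = n])
qed

lemma finite_progression_Int_interval:
  fixes T d a b :: real
  assumes "T > 0"
  shows "finite ({T * of_int n + d |n::int. True} \<inter> {a..b})"
proof (rule finite_subset)
  show "{T * of_int n + d |n::int. True} \<inter> {a..b} \<subseteq> (\<lambda>n. T * of_int n + d) ` {\<lfloor>(a - d) / T\<rfloor>..\<lceil>(b - d) / T\<rceil>}"
  proof safe
    fix n :: int assume "T * of_int n + d \<in> {a..b}"
    then have "(a - d) / T \<le> of_int n" "of_int n \<le> (b - d) / T"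
      using assms by (auto simp: field_simps)
    then have "n \<in> {\<lfloor>(a - d) / T\<rfloor>..\<lceil>(b - d) / T\<rceil>}"
      by (simp, linarith)
    then show "T * of_int n + d \<in> (\<lambda>n. T * of_int n + d) ` {\<lfloor>(a - d) / T\<rfloor>..\<lceil>(b - d) / T\<rceil>}" by blast
  qed
qed auto

text \<open>The fundamental theorem applies on \<open>{t - real i..t}\<close>, which contains only
  finitely many exceptional points. Monotone convergence in \<open>i\<close> gives the half-line,
  and the lower boundary term disappears because \<open>L\<close> tends to 0.\<close>

lemma nn_integral_FTC_atMost:
  fixes L w :: "real \<Rightarrow> real"
  assumes "continuous_on UNIV L" "(L \<longlongrightarrow> 0) at_bot" "\<And>a b. finite (K \<inter> {a..b})"
    and deriv: "\<And>t. t \<notin> K \<Longrightarrow> (L has_vector_derivative w t) (at t)"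
    and [measurable]: "w \<in> borel_measurable borel" and "\<And>t. 0 \<le> w t"
  shows "(\<integral>\<^sup>+u\<in>{..t}. ennreal (w u) \<partial>lborel) = ennreal (L t)"
proof -
  let ?f = "\<lambda>i u. ennreal (w u) * indicator {t - real i..t} u"
  have int: "integral\<^sup>N lborel (?f i) = ennreal (L t - L (t - real i))" for i
  proof (rule nn_integral_has_integral_lebesgue')
    show "(w has_integral L t - L (t - real i)) {t - real i..t}"
      using assms by (intro fundamental_theorem_of_calculus_strong[of "K \<inter> {t - real i..t}"])
         (auto intro: continuous_on_subset)
  qed (use assms in auto)
  have "(\<lambda>i. integral\<^sup>N lborel (?f i)) \<longlonglongrightarrow> (\<integral>\<^sup>+u. ennreal (w u) * indicator {..t} u \<partial>lborel)"
  proof (rule nn_integral_LIMSEQ)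
    show "incseq ?f"
      by (auto simp: incseq_def le_fun_def indicator_def)
    show "(\<lambda>i. ?f i u) \<longlonglongrightarrow> ennreal (w u) * indicator {..t} u" for u
    proof (rule tendsto_eventually)
      show "\<forall>\<^sub>F i in sequentially. ?f i u = ennreal (w u) * indicator {..t} u"
        using eventually_ge_at_top[of "nat \<lceil>t - u\<rceil>"]
        by eventually_elim (auto simp: indicator_def; linarith)
    qed
  qed measurable
  moreover have "(\<lambda>i. integral\<^sup>N lborel (?f i)) \<longlonglongrightarrow> ennreal (L t)"
  proof -
    have "LIM i sequentially. t - real i :> at_bot"
      by real_asymp
    then have "(\<lambda>i. L (t - real i)) \<longlonglongrightarrow> 0"
      by (rule filterlim_compose[OF assms(2)])
    then have "(\<lambda>i. L t - L (t - real i)) \<longlonglongrightarrow> L t - 0"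
      by (intro tendsto_intros)
    then show ?thesis by (simp add: int tendsto_ennrealI)
  qed
  ultimately show ?thesis by (rule LIMSEQ_unique)
qed

section \<open>Polar coordinates, exposure and the search domain\<close>

lemma has_vector_derivative_polar:
  assumes "(g has_real_derivative g') (at s)"
  shows "((\<lambda>s. polar (g s) s) has_vector_derivative
           (g' * cos s - g s * sin s, g' * sin s + g s * cos s)) (at s)"
  unfolding polar_def
  by (intro has_vector_derivative_Pair)
    (use assms in \<open>auto intro!: derivative_eq_intros simp flip: has_real_derivative_iff_has_vector_derivative\<close>)

text \<open>The vector is \<open>(a, b)\<close> rotated by the angle \<open>s\<close>. With
  \<open>a\<close> the derivative of the radius and \<open>b\<close> the radius this is the speed in
  polar coordinates; with \<open>b = 0\<close> it yields the norm of a polar point.\<close>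

lemma norm_polar_derivative:
  "norm (a * cos s - b * sin s, a * sin s + b * cos s) = sqrt (a\<^sup>2 + b\<^sup>2)" for a b s :: real
proof -
  have "(a * cos s - b * sin s)\<^sup>2 + (a * sin s + b * cos s)\<^sup>2 = (a\<^sup>2 + b\<^sup>2) * ((cos s)\<^sup>2 + (sin s)\<^sup>2)"
    by algebra
  then show ?thesis by (simp add: norm_Pair)
qed

lemma norm_polar: "r > 0 \<Longrightarrow> norm (polar r s) = r"
  using norm_polar_derivative[of r s 0] by (simp add: polar_def)

lemma polar_eq_iff:
  assumes "x > 0" "y > 0"
  shows "polar x a = polar y b \<longleftrightarrow> x = y \<and> (\<exists>n::int. a = b + 2 * pi * n)"
proof
  assume eq: "polar x a = polar y b"
  then have "x = y" using assms norm_polar by metis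
  then show "x = y \<and> (\<exists>n::int. a = b + 2 * pi * n)"
    using eq assms by (simp add: polar_def flip: sin_cos_eq_iff)
next
  assume "x = y \<and> (\<exists>n::int. a = b + 2 * pi * n)"
  then show "polar x a = polar y b"
    unfolding sin_cos_eq_iff[symmetric] by (simp add: polar_def)
qed

lemma polar_decomposition:
  assumes "A \<noteq> (0, 0)"
  obtains r s where "r > 0" "0 \<le> s" "s < 2 * pi" "A = polar r s"
proof -
  obtain x y where A: "A = (x, y)" by fastforce
  have pos: "norm A > 0" using assms by (metis zero_less_norm_iff zero_prod_def)
  have "(norm A)\<^sup>2 = x\<^sup>2 + y\<^sup>2" by (simp add: norm_Pair A)
  then have "(x / norm A)\<^sup>2 + (y / norm A)\<^sup>2 = 1"
    using pos by (metis add_divide_distrib divide_self less_irrefl power_divide zero_less_power)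
  then obtain s where "0 \<le> s" "s < 2 * pi" "x / norm A = cos s" "y / norm A = sin s"
    by (rule sincos_total_2pi)
  then show thesis
    using pos by (intro that[of "norm A" s]) (auto simp: polar_def A field_simps)
qed

text \<open>For positive radii a point determines its radius, and its angle modulo
  \<open>2 * pi\<close>; this eliminates the unknown ray in the definition of exposure.\<close>

lemma exposes_polar_iff:
  assumes "x > 0" "y > 0"
  shows "exposes (polar x a) (polar y b) \<longleftrightarrow> y \<le> x \<and> (\<exists>n::int. a = b + 2 * pi * n)"
proof
  assume "exposes (polar x a) (polar y b)"
  then obtain x' y' \<psi> where *: "x' > 0" "y' > 0" "polar x a = polar x' \<psi>" "polar y b = polar y' \<psi>" "y' \<le> x'"
    by (auto simp: exposes_def)
  then obtain m n :: int where "x = x'" "y = y'" "a = \<psi> + 2 * pi * m" "b = \<psi> + 2 * pi * n"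
    using assms by (auto simp: polar_eq_iff)
  then show "y \<le> x \<and> (\<exists>n::int. a = b + 2 * pi * n)"
    using * by (auto intro!: exI[of _ "m - n"] simp: algebra_simps)
next
  assume *: "y \<le> x \<and> (\<exists>n::int. a = b + 2 * pi * n)"
  then have "polar x a = polar x b" using assms by (simp add: polar_eq_iff)
  then show "exposes (polar x a) (polar y b)"
    unfolding exposes_def using assms * by blast
qed

lemma conic_complement_polar:
  assumes "0 < \<phi>" "\<phi> \<le> 2 * pi"
  shows "conic_complement \<phi> = {polar r s |r s. r > 0 \<and> \<phi> \<le> s \<and> s < 2 * pi}"
proof (intro subset_antisym subsetI)
  fix A assume A: "A \<in> conic_complement \<phi>"
  then have "A \<noteq> (0, 0)" by (simp add: conic_complement_def)
  then obtain r s where rs: "r > 0" "0 \<le> s" "s < 2 * pi" "A = polar r s"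
    by (rule polar_decomposition)
  then have "\<phi> \<le> s"
    using A by (force simp: conic_complement_def cone_dom_def ray_def)
  then show "A \<in> {polar r s |r s. r > 0 \<and> \<phi> \<le> s \<and> s < 2 * pi}"
    using rs by blast
next
  fix A assume "A \<in> {polar r s |r s. r > 0 \<and> \<phi> \<le> s \<and> s < 2 * pi}"
  then obtain r s where rs: "r > 0" "\<phi> \<le> s" "s < 2 * pi" and A: "A = polar r s" by blast
  have "polar r s \<noteq> (0, 0)" using norm_polar[OF rs(1), of s] rs(1) by (auto simp: norm_Pair)
  moreover have "polar r s \<notin> cone_dom \<phi>"
  proof
    assume "polar r s \<in> cone_dom \<phi>"
    then obtain \<psi> r' where *: "0 \<le> \<psi>" "\<psi> < \<phi>" "r' > 0" "polar r s = polar r' \<psi>"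
      by (auto simp: cone_dom_def ray_def)
    then obtain n :: int where n: "s = \<psi> + 2 * pi * n"
      using rs by (auto simp: polar_eq_iff)
    \<comment> \<open>The two angles differ, since \<psi> < \<phi> \<le> s, but by less than a full
      turn; no integer \<open>n\<close> fits.\<close>
    have "2 * pi * of_int n > 0" "2 * pi * of_int n < 2 * pi"
      using n * rs by linarith+
    then have "n > 0" "real_of_int n < 1" by (simp_all add: zero_less_mult_iff)
    then show False by simp
  qed
  ultimately show "A \<in> conic_complement \<phi>" by (simp add: A conic_complement_def)
qed

section \<open>Auxiliary facts on \<open>sinh\<close>, \<open>kappa1\<close> and
  measurability\<close>

lemma le_sinh_real: "x \<le> sinh x" if "x \<ge> 0" for x :: real
proof -
  have "sinh 0 - 0 \<le> sinh x - x"
    by (rule DERIV_nonneg_imp_nondecreasing[OF that])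
       (auto intro!: exI derivative_eq_intros cosh_real_ge_1)
  then show ?thesis by simp
qed

text \<open>The definite description yields information only once existence (intermediate value
  theorem on \<open>[0, 1]\<close>) and uniqueness (strict monotonicity of the cubic) are
  known.\<close>

lemma kappa1_pos: "kappa1 > 0"
proof -
  let ?P = "\<lambda>k::real. k > 0 \<and> k ^ 3 + k = 1 / (2 * pi)"
  have "\<exists>k\<ge>0. k \<le> 1 \<and> k ^ 3 + k = 1 / (2 * pi)"
    by (rule IVT) (auto simp: field_simps intro!: continuous_intros, use pi_gt3 in linarith)
  then obtain k :: real where "k \<ge> 0" "k ^ 3 + k = 1 / (2 * pi)" by blast
  then have "?P k" by (cases "k = 0") auto
  moreover have "k' = k" if "?P k'" "?P k" for k k'
  proof (rule ccontr)
    assume "k' \<noteq> k"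
    then consider "k' < k" | "k < k'" by linarith
    then show False
    proof cases
      case 1
      then have "k' ^ 3 < k ^ 3" using that by (intro power_strict_mono) auto
      with 1 that show False by linarith
    next
      case 2
      then have "k ^ 3 < k' ^ 3" using that by (intro power_strict_mono) auto
      with 2 that show False by linarith
    qed
  qed
  ultimately have "\<exists>!k. ?P k" by (intro ex1I) blast+
  then have "?P kappa1" unfolding kappa1_def by (rule theI')
  then show ?thesis by blast
qed

lemma borel_measurable_geo_ext [measurable]:
  fixes h :: "real \<Rightarrow> real"
  assumes "q > 0" and [measurable]: "h \<in> borel_measurable borel"
  shows "geo_ext T q h \<in> borel_measurable borel"
proof -
  have "geo_ext T q h = (\<lambda>t. q powr real_of_int \<lfloor>t / T\<rfloor> * h (t - T * \<lfloor>t / T\<rfloor>))"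
    using assms(1) by (simp add: geo_ext_def fun_eq_iff powr_real_of_int')
  also have "\<dots> \<in> borel_measurable borel" by measurable
  finally show ?thesis .
qed

section \<open>One turn of the curve: a chord followed by a logarithmic spiral\<close>

locale shortcut_spiral =
  fixes \<phi> l :: real
  assumes phi: "0 < \<phi>" "\<phi> < pi" and l_gt_1: "l > 1"
begin

text \<open>Exponential rate of the spiral part. A complete logarithmic spiral of rate
  \<open>k\<close> has length \<open>sqrt (1 + k\<^sup>2) / k\<close> times its final radius; for
  this \<open>k\<close> the ratio is \<open>chord / (l - 1)\<close>.\<close>

definition slope where "slope = (l - 1) / sqrt (2 * l * (1 - cos \<phi>))"
definition chord where "chord = sqrt (l\<^sup>2 - 2 * l * cos \<phi> + 1)"
definition growth where "growth = exp (2 * pi * k_exp \<phi> l)"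

text \<open>The segment from the origin at angle \<open>s\<close> splits the triangle with vertices
  0, \<open>polar 1 0\<close> and \<open>polar l \<phi>\<close>. Comparing doubled areas gives
  \<open>radius s * den s = l * sin \<phi>\<close>.\<close>

definition den where "den s = l * sin (\<phi> - s) + sin s"

text \<open>The first branch is the polar equation of the line through \<open>polar 1 0\<close> and \<open>polar l \<phi>\<close>.\<close>

definition radius where
  "radius s = (if s \<le> \<phi> then l * sin \<phi> / den s else l * exp (slope * (s - \<phi>)))"

text \<open>Length accumulated since minus infinity. The initial value
  \<open>chord / (l - 1)\<close> is the geometric series over all earlier turns, and
  \<open>sin s / den s\<close> is the fraction of the chord already traversed at angle
  \<open>s\<close>.\<close>

definition len where
  "len s = (if s \<le> \<phi> then chord / (l - 1) + chord * (sin s / den s) else chord / (l - 1) * radius s)"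

text \<open>Closed form both for the derivative of \<open>len\<close> and for the norm of the
  velocity of the curve, away from the corners.\<close>

definition speed where
  "speed s = (if s \<le> \<phi> then l * sin \<phi> * chord / (den s)\<^sup>2 else chord / (l - 1) * slope * radius s)"

text \<open>The parameter is the unreduced polar angle, so one turn is one period and negative
  parameters wind into the origin.\<close>

definition tau where "tau t = polar (geo_ext (2 * pi) growth radius t) t"

lemma cos_phi_less_1: "cos \<phi> < 1"
  using cos_monotone_0_pi[of 0 \<phi>] phi by simp

lemma sin_phi_pos: "sin \<phi> > 0"
  using phi by (simp add: sin_gt_zero)

lemma slope_pos: "slope > 0"
  using l_gt_1 cos_phi_less_1 by (simp add: slope_def)

lemma chord_sq: "chord\<^sup>2 = (l - 1)\<^sup>2 + 2 * l * (1 - cos \<phi>)" and chord_pos: "chord > 0"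
proof -
  have eq: "l\<^sup>2 - 2 * l * cos \<phi> + 1 = (l - 1)\<^sup>2 + 2 * l * (1 - cos \<phi>)"
    by (simp add: power2_eq_square algebra_simps)
  have "(l - 1)\<^sup>2 + 2 * l * (1 - cos \<phi>) > 0"
    using l_gt_1 cos_phi_less_1 by (intro add_pos_pos mult_pos_pos) auto
  then show "chord\<^sup>2 = (l - 1)\<^sup>2 + 2 * l * (1 - cos \<phi>)" "chord > 0"
    unfolding chord_def eq by auto
qed

text \<open>On the spiral the velocity has norm \<open>sqrt (1 + slope\<^sup>2)\<close> times the
  radius, whereas \<open>len\<close> grows at \<open>chord / (l - 1) * slope\<close> times the
  radius; the two rates must agree.\<close>

lemma chord_slope: "chord / (l - 1) * slope = sqrt (1 + slope\<^sup>2)"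
proof -
  let ?K = "2 * l * (1 - cos \<phi>)"
  have K: "?K > 0" using l_gt_1 cos_phi_less_1 by simp
  then have "slope\<^sup>2 = (l - 1)\<^sup>2 / ?K" by (simp add: slope_def power_divide)
  then have "1 + slope\<^sup>2 = chord\<^sup>2 / ?K"
    using K unfolding chord_sq by (simp only: add_divide_distrib) (auto simp: add.commute)
  then have "sqrt (1 + slope\<^sup>2) = chord / sqrt ?K"
    using chord_pos by (simp add: real_sqrt_divide)
  then show ?thesis using l_gt_1 by (simp add: slope_def)
qed

text \<open>The chord contributes the factor \<open>l\<close>, the spiral the exponential over the
  remaining angle \<open>2 * pi - \<phi>\<close>.\<close>

lemma growth_eq: "growth = l * exp (slope * (2 * pi - \<phi>))"
proof -
  have "2 * pi * k_exp \<phi> l = ln l + slope * (2 * pi - \<phi>)"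
  proof -
    have "k_exp \<phi> l = ln l / (2 * pi) + slope * (1 - \<phi> / (2 * pi))"
      by (simp add: k_exp_def slope_def)
    then show ?thesis by (simp add: distrib_left right_diff_distrib)
  qed
  then show ?thesis using l_gt_1 by (simp add: growth_def exp_add)
qed

lemma growth_gt_1: "growth > 1"
proof -
  have "slope * (2 * pi - \<phi>) > 0" using slope_pos phi by simp
  then have "l * exp (slope * (2 * pi - \<phi>)) > 1 * 1"
    using l_gt_1 by (intro mult_strict_mono) auto
  then show ?thesis by (simp add: growth_eq)
qed

lemma cost_fun_eq: "cost_fun \<phi> l = chord / (l - 1) * growth"
  by (simp add: cost_fun_def chord_def growth_def)

lemma den_pos: "den s > 0" if "0 \<le> s" "s \<le> \<phi>"
proof (cases "s = 0")
  case True
  then show ?thesis using l_gt_1 sin_phi_pos by (simp add: den_def)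
next
  case False
  then have "sin s > 0" "sin (\<phi> - s) \<ge> 0" 
    using that phi by (auto intro: sin_gt_zero sin_ge_zero)
  then show ?thesis using l_gt_1 by (simp add: den_def add_nonneg_pos)
qed

lemma den_phi [simp]: "den \<phi> = sin \<phi>" and den_0 [simp]: "den 0 = l * sin \<phi>"
  by (simp_all add: den_def)

lemma radius_0: "radius 0 = 1" and radius_phi: "radius \<phi> = l" and radius_2pi: "radius (2 * pi) = growth"
  using phi l_gt_1 sin_phi_pos by (auto simp: radius_def growth_eq)

text \<open>The ratio of length to radius is the same at both ends of the chord, since
  \<open>chord / (l - 1) + chord = chord / (l - 1) * l\<close>; the spiral then preserves
  it.\<close>

lemma len_0: "len 0 = chord / (l - 1)"
  and len_2pi: "len (2 * pi) = chord / (l - 1) * growth"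
  and len_spiral: "s \<ge> \<phi> \<Longrightarrow> len s = chord / (l - 1) * radius s"
proof -
  show "len 0 = chord / (l - 1)" using phi by (simp add: len_def)
  show spiral: "len s = chord / (l - 1) * radius s" if "s \<ge> \<phi>" for s
  proof (cases "s = \<phi>")
    case True
    then show ?thesis using l_gt_1 sin_phi_pos by (simp add: len_def radius_phi field_simps)
  next
    case False
    then show ?thesis using that by (simp add: len_def)
  qed
  show "len (2 * pi) = chord / (l - 1) * growth"
    using phi by (simp add: spiral radius_2pi)
qed

lemma radius_pos: "radius s > 0" if "0 \<le> s"
  using that l_gt_1 sin_phi_pos by (auto simp: radius_def den_pos)

lemma continuous_radius: "continuous_on {0..2 * pi} radius"
proof -
  have ne: "den s \<noteq> 0" if "s \<in> {0..\<phi>}" for s using den_pos[of s] that by auto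
  have "continuous_on ({0..\<phi>} \<union> {\<phi>..2 * pi})
    (\<lambda>s. if s \<le> \<phi> then l * sin \<phi> / den s else l * exp (slope * (s - \<phi>)))"
    using ne sin_phi_pos
    by (intro continuous_on_If) (auto intro!: continuous_intros simp: den_def)
  moreover have "{0..\<phi>} \<union> {\<phi>..2 * pi} = {0..2 * pi}" using phi by auto
  ultimately show ?thesis by (simp add: radius_def[abs_def])
qed

lemma continuous_len: "continuous_on {0..2 * pi} len"
proof -
  have ne: "den s \<noteq> 0" if "s \<in> {0..\<phi>}" for s using den_pos[of s] that by auto
  have "continuous_on {\<phi>..2 * pi} radius"
    using phi by (intro continuous_on_subset[OF continuous_radius]) auto
  then have "continuous_on ({0..\<phi>} \<union> {\<phi>..2 * pi})
    (\<lambda>s. if s \<le> \<phi> then chord / (l - 1) + chord * (sin s / den s) else chord / (l - 1) * radius s)"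
    using ne sin_phi_pos l_gt_1
    by (intro continuous_on_If) (auto intro!: continuous_intros simp: den_def radius_phi field_simps)
  moreover have "{0..\<phi>} \<union> {\<phi>..2 * pi} = {0..2 * pi}" using phi by auto
  ultimately show ?thesis by (simp add: len_def[abs_def])
qed

text \<open>As a function of \<open>s\<close>, \<open>den\<close> is a sinusoid of amplitude
  \<open>chord\<close>, and the second square is that of its derivative.\<close>

lemma den_deriv_sq: "(den s)\<^sup>2 + (cos s - l * cos (\<phi> - s))\<^sup>2 = chord\<^sup>2"
proof -
  have "cos \<phi> = cos (\<phi> - s) * cos s - sin (\<phi> - s) * sin s"
    using cos_add[of "\<phi> - s" s] by simp
  moreover have "(sin s)\<^sup>2 + (cos s)\<^sup>2 = 1" "(sin (\<phi> - s))\<^sup>2 + (cos (\<phi> - s))\<^sup>2 = 1" by simp_all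
  ultimately show ?thesis unfolding chord_sq den_def by algebra
qed

lemma one_turn_derivatives:
  assumes "0 < s" "s < 2 * pi" "s \<noteq> \<phi>"
  obtains r' where "(radius has_real_derivative r') (at s)"
    "(len has_real_derivative speed s) (at s)" "sqrt (r'\<^sup>2 + (radius s)\<^sup>2) = speed s"
proof (cases "s < \<phi>")
  case True
  let ?d = "cos s - l * cos (\<phi> - s)"
  have den: "den s > 0" using den_pos assms True by simp
  have den': "(den has_real_derivative ?d) (at s)"
    unfolding den_def by (auto intro!: derivative_eq_intros)
  have ev: "open {..<\<phi>}" "s \<in> {..<\<phi>}" using True by auto
  show thesis
  proof
    have "((\<lambda>s. l * sin \<phi> / den s) has_real_derivative - (l * sin \<phi> * ?d / (den s)\<^sup>2)) (at s)"
      using den by (auto intro!: derivative_eq_intros den' simp: power2_eq_square)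
    then show "(radius has_real_derivative - (l * sin \<phi> * ?d / (den s)\<^sup>2)) (at s)"
      by (rule has_field_derivative_transform_within_open[OF _ ev]) (auto simp: radius_def)
    \<comment> \<open>This Wronskian is constant because \<open>sin\<close> and \<open>den\<close>
      both solve \<open>y'' = - y\<close>; it is the numerator in the quotient rule for
      \<open>sin s / den s\<close>.\<close>
    have "cos s * den s - sin s * ?d = l * sin \<phi>"
    proof -
      have "sin \<phi> = sin (\<phi> - s) * cos s + cos (\<phi> - s) * sin s"
        using sin_add[of "\<phi> - s" s] by simp
      then show ?thesis by (simp add: den_def algebra_simps)
    qed
    then have "((\<lambda>s. sin s / den s) has_real_derivative l * sin \<phi> / (den s)\<^sup>2) (at s)"
      using den by (auto intro!: derivative_eq_intros den' simp: power2_eq_square)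
    then have "((\<lambda>s. chord / (l - 1) + chord * (sin s / den s)) has_real_derivative speed s) (at s)"
      using True by (auto intro!: DERIV_add[of _ 0, simplified] dest: DERIV_cmult[of _ _ _ _ chord]
          simp: speed_def mult_ac)
    then show "(len has_real_derivative speed s) (at s)"
      by (rule has_field_derivative_transform_within_open[OF _ ev]) (auto simp: len_def)
    have "(- (l * sin \<phi> * ?d / (den s)\<^sup>2))\<^sup>2 + (radius s)\<^sup>2
        = (l * sin \<phi>)\<^sup>2 * ((den s)\<^sup>2 + ?d\<^sup>2) / ((den s)\<^sup>2)\<^sup>2"
      using True den by (simp add: radius_def field_simps power2_eq_square)
    also have "\<dots> = (speed s)\<^sup>2"
      using True by (simp add: den_deriv_sq speed_def power_divide power_mult_distrib)
    finally show "sqrt ((- (l * sin \<phi> * ?d / (den s)\<^sup>2))\<^sup>2 + (radius s)\<^sup>2) = speed s"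
      using True sin_phi_pos chord_pos l_gt_1 by (simp add: speed_def)
  qed
next
  case False
  then have gt: "s > \<phi>" using assms by simp
  have ev: "open {\<phi><..}" "s \<in> {\<phi><..}" using gt by auto
  show thesis
  proof
    have "((\<lambda>s. l * exp (slope * (s - \<phi>))) has_real_derivative slope * radius s) (at s)"
      using gt by (auto intro!: derivative_eq_intros simp: radius_def)
    then show r: "(radius has_real_derivative slope * radius s) (at s)"
      by (rule has_field_derivative_transform_within_open[OF _ ev]) (auto simp: radius_def)
    have "((\<lambda>s. chord / (l - 1) * radius s) has_real_derivative speed s) (at s)"
      using gt DERIV_cmult[OF r, of "chord / (l - 1)"] by (simp add: speed_def mult_ac)
    then show "(len has_real_derivative speed s) (at s)"
      by (rule has_field_derivative_transform_within_open[OF _ ev]) (auto simp: len_def)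
    have "(slope * radius s)\<^sup>2 + (radius s)\<^sup>2 = (1 + slope\<^sup>2) * (radius s)\<^sup>2"
      by (simp add: power_mult_distrib algebra_simps)
    then show "sqrt ((slope * radius s)\<^sup>2 + (radius s)\<^sup>2) = speed s"
      using gt assms radius_pos[of s] by (simp add: real_sqrt_mult speed_def flip: chord_slope)
  qed
qed

lemma speed_nonneg: "0 \<le> s \<Longrightarrow> 0 \<le> speed s"
  using l_gt_1 sin_phi_pos chord_pos slope_pos radius_pos[of s] by (auto simp: speed_def)

lemma borel_measurable_speed: "speed \<in> borel_measurable borel"
  unfolding speed_def radius_def den_def by measurable

section \<open>The whole curve and its travelled length\<close>

text \<open>Starts and ends of the chords. The summand \<open>0\<close> brings both families into
  the shape of \<open>finite_progression_Int_interval\<close>.\<close>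

definition breaks where
  "breaks = {2 * pi * of_int n + 0 |n::int. True} \<union> {2 * pi * of_int n + \<phi> |n::int. True}"

lemma finite_breaks: "finite (breaks \<inter> {a..b})"
  unfolding breaks_def Int_Un_distrib2
  by (intro finite_UnI finite_progression_Int_interval) simp_all

lemma not_breaks:
  assumes "t \<notin> breaks"
  obtains n s where "t = 2 * pi * of_int n + s" "0 < s" "s < 2 * pi" "s \<noteq> \<phi>"
proof -
  define n s where "n = \<lfloor>t / (2 * pi)\<rfloor>" and "s = t - 2 * pi * of_int n"
  have "0 \<le> s" "s < 2 * pi"
    using floor_period[of "2 * pi" t] by (auto simp: n_def s_def algebra_simps)
  moreover have "s \<noteq> 0" "s \<noteq> \<phi>"
    using assms by (auto simp: breaks_def s_def algebra_simps)
  ultimately show thesis using that[of n s] by (simp add: s_def)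
qed

text \<open>Both derivatives come from a single turn by scaling with \<open>growth powi n\<close>;
  the rotation by whole turns does not change norms.\<close>

lemma tau_derivatives:
  assumes "t \<notin> breaks"
  obtains v where "(tau has_vector_derivative v) (at t)" "norm v = geo_ext (2 * pi) growth speed t"
    "(geo_ext (2 * pi) growth len has_vector_derivative geo_ext (2 * pi) growth speed t) (at t)"
proof -
  obtain n s where t: "t = 2 * pi * of_int n + s" and s: "0 < s" "s < 2 * pi" "s \<noteq> \<phi>"
    using not_breaks[OF assms] .
  obtain r' where r': "(radius has_real_derivative r') (at s)"
    "(len has_real_derivative speed s) (at s)" "sqrt (r'\<^sup>2 + (radius s)\<^sup>2) = speed s"
    using one_turn_derivatives[OF s] .
  let ?q = "growth powi n"
  have q: "?q > 0" using growth_gt_1 by simp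
  have val: "geo_ext (2 * pi) growth h t = ?q *\<^sub>R h s" for h :: "real \<Rightarrow> real"
    using s by (subst geo_ext_eq_less[where n = n]) (auto simp: t algebra_simps)
  have "(geo_ext (2 * pi) growth radius has_vector_derivative ?q *\<^sub>R r') (at t)"
    unfolding t using s r'(1)
    by (intro has_vector_derivative_geo_ext) (auto simp: has_real_derivative_iff_has_vector_derivative)
  then have rad: "(geo_ext (2 * pi) growth radius has_real_derivative ?q * r') (at t)"
    by (simp add: has_real_derivative_iff_has_vector_derivative)
  show thesis
  proof
    show "(tau has_vector_derivative (?q * r' * cos t - geo_ext (2 * pi) growth radius t * sin t,
        ?q * r' * sin t + geo_ext (2 * pi) growth radius t * cos t)) (at t)"
      unfolding tau_def[abs_def] by (rule has_vector_derivative_polar[OF rad])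
    have "(?q * r')\<^sup>2 + (?q * radius s)\<^sup>2 = ?q\<^sup>2 * (r'\<^sup>2 + (radius s)\<^sup>2)"
      by (simp add: power_mult_distrib algebra_simps)
    then show "norm (?q * r' * cos t - geo_ext (2 * pi) growth radius t * sin t,
        ?q * r' * sin t + geo_ext (2 * pi) growth radius t * cos t) = geo_ext (2 * pi) growth speed t"
      using q r'(3) by (simp add: norm_polar_derivative val real_sqrt_mult)
    show "(geo_ext (2 * pi) growth len has_vector_derivative geo_ext (2 * pi) growth speed t) (at t)"
      unfolding val unfolding t using s r'(2)
      by (intro has_vector_derivative_geo_ext) (auto simp: has_real_derivative_iff_has_vector_derivative)
  qed
qed

lemma continuous_tau: "continuous_on UNIV tau"
proof -
  have "continuous_on UNIV (geo_ext (2 * pi) growth radius)"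
    using growth_gt_1 by (intro continuous_geo_ext continuous_radius) (auto simp: radius_0 radius_2pi)
  then show ?thesis unfolding tau_def[abs_def] polar_def by (intro continuous_intros)
qed

lemma tau_tendsto_0: "(tau \<longlongrightarrow> (0, 0)) at_bot"
proof -
  have lim: "(geo_ext (2 * pi) growth radius \<longlongrightarrow> 0) at_bot"
    using growth_gt_1 by (intro geo_ext_tendsto_0 continuous_radius) auto
  show ?thesis unfolding tau_def[abs_def] polar_def
  proof (rule tendsto_Pair)
    show "((\<lambda>t. geo_ext (2 * pi) growth radius t * cos t) \<longlongrightarrow> 0) at_bot"
      by (rule Lim_null_comparison[OF _ tendsto_norm_zero[OF lim]])
         (simp add: abs_mult mult_left_le)
    show "((\<lambda>t. geo_ext (2 * pi) growth radius t * sin t) \<longlongrightarrow> 0) at_bot"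
      by (rule Lim_null_comparison[OF _ tendsto_norm_zero[OF lim]])
         (simp add: abs_mult mult_left_le)
  qed
qed

lemma piecewise_differentiable_tau: "tau piecewise_differentiable_on {a..b}"
  unfolding piecewise_differentiable_on_def
proof (intro conjI exI[of _ "breaks \<inter> {a..b}"] ballI)
  show "continuous_on {a..b} tau" using continuous_tau by (rule continuous_on_subset) simp
  show "finite (breaks \<inter> {a..b})" by (rule finite_breaks)
  fix t assume "t \<in> {a..b} - breaks \<inter> {a..b}"
  then have "t \<notin> breaks" by blast
  then obtain v where "(tau has_vector_derivative v) (at t)" by (rule tau_derivatives)
  then show "tau differentiable (at t within {a..b})"
    by (auto simp: has_vector_derivative_def intro: differentiableI differentiable_at_withinI)
qed

text \<open>The extension of \<open>len\<close> vanishes at minus infinity and is an antiderivative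
  of the speed off the breakpoints, which are countable and hence null.\<close>

lemma travel_time_tau: "travel_time tau t = ennreal (geo_ext (2 * pi) growth len t)"
proof -
  let ?w = "geo_ext (2 * pi) growth speed"
  have nonneg: "0 \<le> ?w t" for t
    using growth_gt_1 floor_period(1)[of "2 * pi" t] speed_nonneg by (auto simp: geo_ext_def)
  have "countable breaks"
    unfolding breaks_def by (simp add: full_SetCompr_eq)
  then have "AE t in lborel. t \<notin> breaks"
    by (intro AE_not_in countable_imp_null_set_lborel)
  then have "AE t in lborel. norm (vector_derivative tau (at t)) = ?w t"
  proof eventually_elim
    case (elim t)
    then obtain v where "(tau has_vector_derivative v) (at t)" "norm v = ?w t" by (rule tau_derivatives)
    then show ?case by (simp add: vector_derivative_at)
  qed
  then have "travel_time tau t = (\<integral>\<^sup>+u\<in>{..t}. ennreal (?w u) \<partial>lborel)"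
    unfolding travel_time_def by (intro nn_integral_cong_AE) auto
  also have "\<dots> = ennreal (geo_ext (2 * pi) growth len t)"
  proof (rule nn_integral_FTC_atMost[OF _ _ finite_breaks _ _ nonneg])
    show "continuous_on UNIV (geo_ext (2 * pi) growth len)"
      using growth_gt_1 by (intro continuous_geo_ext continuous_len) (auto simp: len_0 len_2pi)
    show "(geo_ext (2 * pi) growth len \<longlongrightarrow> 0) at_bot"
      using growth_gt_1 by (intro geo_ext_tendsto_0 continuous_len) auto
    show "?w \<in> borel_measurable borel"
      using growth_gt_1 borel_measurable_speed by (intro borel_measurable_geo_ext) auto
    show "(geo_ext (2 * pi) growth len has_vector_derivative ?w t) (at t)" if "t \<notin> breaks" for t
      using that by (rule tau_derivatives)
  qed
  finally show ?thesis .
qed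

section \<open>First exposure and the search cost\<close>

lemma exposes_tau_iff:
  assumes "r > 0" "0 \<le> s" "s < 2 * pi"
  shows "exposes (tau t) (polar r s) \<longleftrightarrow> (\<exists>n::int. t = s + 2 * pi * n \<and> r \<le> growth powi n * radius s)"
proof -
  have pos: "geo_ext (2 * pi) growth radius t > 0" for t
    using growth_gt_1 floor_period(1)[of "2 * pi" t] radius_pos by (auto simp: geo_ext_def)
  have "geo_ext (2 * pi) growth radius (s + 2 * pi * of_int n) = growth powi n * radius s" for n
    using assms by (subst geo_ext_eq_less[where n = n]) (auto simp: algebra_simps)
  then show ?thesis
    unfolding tau_def using assms(1) pos by (auto simp: exposes_polar_iff)
qed

lemma travel_time_spiral:
  assumes "\<phi> \<le> s" "s < 2 * pi"
  shows "travel_time tau (s + 2 * pi * of_int n) = ennreal (chord / (l - 1) * (growth powi n * radius s))"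
  using assms phi unfolding travel_time_tau
  by (subst geo_ext_eq_less[where n = n]) (auto simp: algebra_simps len_spiral)

text \<open>Radii along a fixed ray increase with the turn number, so once turn \<open>n - 1\<close>
  falls short, all earlier turns do.\<close>

lemma exposure_param_tau:
  assumes "r > 0" "0 \<le> s" "s < 2 * pi"
    and "growth powi (n - 1) * radius s < r" "r \<le> growth powi n * radius s"
  shows "exposure_param tau (polar r s) = s + 2 * pi * of_int n"
  unfolding exposure_param_def
proof (rule Least_equality)
  show "exposes (tau (s + 2 * pi * of_int n)) (polar r s)"
    using assms by (auto simp: exposes_tau_iff)
  fix t assume "exposes (tau t) (polar r s)"
  then obtain m :: int where m: "t = s + 2 * pi * m" "r \<le> growth powi m * radius s"
    using assms by (auto simp: exposes_tau_iff)
  have "growth powi (n - 1) < growth powi m"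
    using m(2) assms(4) radius_pos[OF assms(2)] by (meson less_le_trans mult_less_cancel_right_pos)
  have "n \<le> m"
  proof (rule ccontr)
    assume "\<not> n \<le> m"
    then have "growth powi m \<le> growth powi (n - 1)"
      using growth_gt_1 by (intro power_int_increasing) auto
    then show False using \<open>growth powi (n - 1) < growth powi m\<close> by simp
  qed
  then show "s + 2 * pi * of_int n \<le> t" using m by simp
qed

lemma exposing_turn:
  assumes "r > 0" "0 \<le> s"
  obtains n :: int where "growth powi (n - 1) * radius s < r" "r \<le> growth powi n * radius s"
proof -
  \<comment> \<open>The real turn number at which the radius would be exactly \<open>r\<close>; the
    exposing turn is its ceiling.\<close>
  define x where "x = log growth (r / radius s)"
  have x: "r = growth powr x * radius s"
    using assms radius_pos[of s] growth_gt_1 by (simp add: x_def)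
  have "growth powi (\<lceil>x\<rceil> - 1) < growth powr x" "growth powr x \<le> growth powi \<lceil>x\<rceil>"
    using growth_gt_1 by (auto simp flip: powr_real_of_int'; linarith)+
  then show thesis
    using radius_pos[OF assms(2)] that[of "\<lceil>x\<rceil>"] by (simp add: x)
qed

lemma feasible_tau: "feasible (conic_complement \<phi>) tau"
  unfolding feasible_def
proof (intro conjI allI ballI continuous_tau piecewise_differentiable_tau tau_tendsto_0)
  fix A assume "A \<in> conic_complement \<phi>"
  then obtain r s where A: "A = polar r s" "r > 0" "\<phi> \<le> s" "s < 2 * pi"
    using conic_complement_polar[of \<phi>] phi by auto
  then obtain n :: int where "r \<le> growth powi n * radius s"
    using exposing_turn[of r s] phi by (metis less_le_trans less_imp_le)
  then show "\<exists>t. exposes (tau t) A"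
    using A phi by (auto simp: exposes_tau_iff)
qed

text \<open>A point first exposed in turn \<open>n\<close> lies beyond the radius of turn
  \<open>n - 1\<close>, so the ratio of exposing radius to distance is below \<open>growth\<close>.
  The supremum is only approached, by points just beyond an earlier visit.\<close>

lemma search_cost_tau: "search_cost (conic_complement \<phi>) tau = ennreal (cost_fun \<phi> l)"
proof (rule antisym)
  have F: "chord / (l - 1) > 0" using chord_pos l_gt_1 by simp
  have cost: "travel_time tau (exposure_param tau (polar r s)) / ennreal (norm (polar r s))
      = ennreal (chord / (l - 1) * (growth powi n * radius s) / r)"
    if "r > 0" "\<phi> \<le> s" "s < 2 * pi" "growth powi (n - 1) * radius s < r" "r \<le> growth powi n * radius s"
    for r s n
  proof -
    have "chord / (l - 1) * (growth powi n * radius s) \<ge> 0"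
      using F growth_gt_1 radius_pos[of s] phi that by (intro mult_nonneg_nonneg) auto
    then show ?thesis
      using that phi by (simp add: exposure_param_tau travel_time_spiral norm_polar divide_ennreal)
  qed
  show "search_cost (conic_complement \<phi>) tau \<le> ennreal (cost_fun \<phi> l)"
    unfolding search_cost_def
  proof (rule SUP_least)
    fix A assume "A \<in> conic_complement \<phi>"
    then obtain r s where A: "A = polar r s" "r > 0" "\<phi> \<le> s" "s < 2 * pi"
      using conic_complement_polar[of \<phi>] phi by auto
    obtain n where n: "growth powi (n - 1) * radius s < r" "r \<le> growth powi n * radius s"
      using exposing_turn[of r s] A phi by auto
    have "growth powi n * radius s \<le> growth * r"
      using n(1) growth_gt_1 by (simp add: power_int_diff field_simps)
    then have "growth powi n * radius s / r \<le> growth"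
      using A by (simp add: field_simps)
    then have "chord / (l - 1) * (growth powi n * radius s / r) \<le> chord / (l - 1) * growth"
      using F by (intro mult_left_mono) auto
    then show "travel_time tau (exposure_param tau A) / ennreal (norm A) \<le> ennreal (cost_fun \<phi> l)"
      unfolding A(1) cost[OF A(2-4) n] cost_fun_eq by (intro ennreal_leI) simp
  qed
  show "ennreal (cost_fun \<phi> l) \<le> search_cost (conic_complement \<phi>) tau"
    unfolding search_cost_def
  proof (rule tendsto_upperbound)
    show "((\<lambda>x. ennreal (cost_fun \<phi> l / x)) \<longlongrightarrow> ennreal (cost_fun \<phi> l)) (at_right 1)"
      by (rule tendsto_ennrealI) (auto intro!: tendsto_eq_intros)
    have "ennreal (cost_fun \<phi> l / x) \<le> (SUP A\<in>conic_complement \<phi>. travel_time tau (exposure_param tau A) / ennreal (norm A))"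
      if x: "1 < x" "x < growth" for x
    proof (rule SUP_upper2)
      \<comment> \<open>The curve met the ray at angle \<phi> with radius \<open>l / growth\<close>
        one turn before reaching \<open>polar l \<phi>\<close>. For \<open>x\<close> slightly above
        1 the point was just missed and is exposed in turn 0.\<close>
      let ?r = "l / growth * x"
      show "polar ?r \<phi> \<in> conic_complement \<phi>"
        using x l_gt_1 phi by (auto simp: conic_complement_polar intro!: exI)
      have "growth powi (0 - 1) * radius \<phi> < ?r" "?r \<le> growth powi 0 * radius \<phi>"
        using x l_gt_1 by (auto simp: radius_phi power_int_minus field_simps)
      moreover have "cost_fun \<phi> l / x = chord / (l - 1) * l / ?r"
        using x l_gt_1 growth_gt_1 by (simp add: cost_fun_eq)
      ultimately show "ennreal (cost_fun \<phi> l / x) \<le> travel_time tau (exposure_param tau (polar ?r \<phi>)) / ennreal (norm (polar ?r \<phi>))"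
        using x l_gt_1 phi by (subst cost[of _ _ 0]) (auto simp: radius_phi)
    qed
    then show "\<forall>\<^sub>F x in at_right 1. ennreal (cost_fun \<phi> l / x)
        \<le> (SUP A\<in>conic_complement \<phi>. travel_time tau (exposure_param tau A) / ennreal (norm A))"
      using growth_gt_1 by (auto simp: eventually_at_right)
  qed simp
qed

end

section \<open>Minimum of the cost function and comparison with \<open>U1\<close>\<close>

text \<open>Strictness comes from halving the angle: \<open>sin x = 2 * sin (x / 2) * cos (x / 2) <
  2 * sin (x / 2) \<le> x\<close>.\<close>

lemma sin_less_real: "sin x < x" if "x > 0" for x :: real
proof (cases "x < 2")
  case True
  then have "x / 2 < pi" using pi_gt3 by simp
  then have "sin (x / 2) > 0" "cos (x / 2) < 1"
    using that cos_monotone_0_pi[of 0 "x / 2"] by (auto intro: sin_gt_zero)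
  then have "sin (x / 2) * cos (x / 2) < sin (x / 2) * 1" by (intro mult_strict_left_mono)
  then show ?thesis
    using sin_double[of "x / 2"] sin_x_le_x[of "x / 2"] that by simp
next
  case False
  then show ?thesis using sin_le_one[of x] by linarith
qed

text \<open>The bounds \<open>low1\<close> and \<open>low2\<close> force the cost to blow up at 1
  and at infinity, so minimizing over a compact interval suffices.\<close>

lemma cost_fun_attains_minimum:
  assumes "0 < \<phi>" "\<phi> < pi"
  shows "\<exists>R. is_minimum_on (cost_fun \<phi>) {1<..} R"
proof -
  have c: "cos \<phi> < 1" using cos_monotone_0_pi[of 0 \<phi>] assms by simp
  define d where "d = sqrt (2 * (1 - cos \<phi>))"
  have d: "d > 0" using c by (simp add: d_def)
  have chord: "x\<^sup>2 - 2 * x * cos \<phi> + 1 = (x - 1)\<^sup>2 + 2 * x * (1 - cos \<phi>)" for x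
    by (simp add: power2_eq_square algebra_simps)
  have k: "x \<le> exp (2 * pi * k_exp \<phi> x)" if "x > 1" for x
  proof -
    have "0 \<le> (x - 1) / sqrt (2 * x * (1 - cos \<phi>)) * (1 - \<phi> / (2 * pi))"
      using that c assms by (intro mult_nonneg_nonneg divide_nonneg_nonneg) auto
    then have "2 * pi * (ln x / (2 * pi)) \<le> 2 * pi * k_exp \<phi> x"
      unfolding k_exp_def by (intro mult_left_mono) auto
    then have "exp (ln x) \<le> exp (2 * pi * k_exp \<phi> x)" by simp
    then show ?thesis using that by simp
  qed
  have low1: "d / (x - 1) \<le> cost_fun \<phi> x" if "x > 1" for x
  proof -
    have "2 * (1 - cos \<phi>) * 1 \<le> 2 * (1 - cos \<phi>) * x" using that c by (intro mult_left_mono) auto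
    then have "d \<le> sqrt (x\<^sup>2 - 2 * x * cos \<phi> + 1)"
      unfolding d_def chord by (intro real_sqrt_le_mono add_increasing) (auto simp: mult_ac)
    then have "d / (x - 1) \<le> sqrt (x\<^sup>2 - 2 * x * cos \<phi> + 1) / (x - 1)" (is "_ \<le> ?S")
      using that by (intro divide_right_mono) auto
    moreover have "d / (x - 1) > 0" "1 \<le> exp (2 * pi * k_exp \<phi> x)"
      using d that k[OF that] by (simp_all only: zero_less_divide_iff) auto
    ultimately have "d / (x - 1) * 1 \<le> ?S * exp (2 * pi * k_exp \<phi> x)"
      by (intro mult_mono) linarith+
    then show ?thesis by (simp add: cost_fun_def)
  qed
  have low2: "x \<le> cost_fun \<phi> x" if "x > 1" for x
  proof -
    have "0 \<le> 2 * x * (1 - cos \<phi>)" using that c by simp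
    then have "x - 1 \<le> sqrt (x\<^sup>2 - 2 * x * cos \<phi> + 1)"
      unfolding chord by (intro real_le_rsqrt) simp
    then have "1 \<le> sqrt (x\<^sup>2 - 2 * x * cos \<phi> + 1) / (x - 1)" (is "_ \<le> ?S")
      using that by (simp add: le_divide_eq)
    then have "1 * x \<le> ?S * exp (2 * pi * k_exp \<phi> x)"
      using that k[OF that] by (intro mult_mono) linarith+
    then show ?thesis by (simp add: cost_fun_def)
  qed
  define M where "M = cost_fun \<phi> 2"
  have M: "M \<ge> 2" using low2[of 2] by (simp add: M_def)
  \<comment> \<open>To the left of \<open>1 + d / M\<close> the bound \<open>low1\<close> exceeds
    the reference value \<open>M\<close>, and to the right of \<open>M\<close> so does
    \<open>low2\<close>; the \<open>min\<close> keeps the reference point 2 inside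
    \<open>{a..M}\<close>.\<close>
  define a where "a = min 2 (1 + d / M)"
  have a: "a > 1" using d M by (simp add: a_def)
  have "continuous_on {a..M} (cost_fun \<phi>)"
  proof -
    have "x * (1 - cos \<phi>) \<noteq> 0" "x > 1" if "x \<in> {a..M}" for x using that a c by auto
    then show ?thesis
      unfolding cost_fun_def[abs_def] k_exp_def using a c by (intro continuous_intros) fastforce+
  qed
  moreover have two: "2 \<in> {a..M}" using M by (auto simp: a_def)
  ultimately obtain m where m: "m \<in> {a..M}" "\<And>x. x \<in> {a..M} \<Longrightarrow> cost_fun \<phi> m \<le> cost_fun \<phi> x"
    using continuous_attains_inf[of "{a..M}" "cost_fun \<phi>"] by auto
  have "cost_fun \<phi> m \<le> cost_fun \<phi> x" if x: "x > 1" for x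
  proof -
    have mM: "cost_fun \<phi> m \<le> M" using m(2)[OF two] by (simp add: M_def)
    consider "x < a" | "x \<in> {a..M}" | "x > M" by fastforce
    then show ?thesis
    proof cases
      case 1
      then have "M * (x - 1) \<le> d" using M by (simp add: a_def field_simps)
      then have "M \<le> d / (x - 1)" using x by (simp add: field_simps)
      then show ?thesis using mM low1[OF x] by linarith
    next
      case 2
      then show ?thesis by (rule m(2))
    next
      case 3
      then show ?thesis using mM low2[OF x] by linarith
    qed
  qed
  then show ?thesis
    using m(1) a unfolding is_minimum_on_def by (intro exI[of _ "cost_fun \<phi> m"]) auto
qed

lemma exists_cost_less_U1:
  assumes "0 < \<phi>" "\<phi> < pi"
  shows "\<exists>x>1. cost_fun \<phi> x < U1"
proof -
  \<comment> \<open>With \<open>x = exp (2 * u)\<close> the common factor \<open>2 * exp u\<close>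
    cancels and \<open>slope = sinh u / sin (\<phi> / 2)\<close>; this \<open>u\<close> makes it
    \<open>kappa1\<close>.\<close>
  define u where "u = arsinh (kappa1 * sin (\<phi> / 2))"
  define x where "x = exp (2 * u)"
  have s: "sin (\<phi> / 2) > 0" using assms by (intro sin_gt_zero) auto
  have sinh_u: "sinh u = kappa1 * sin (\<phi> / 2)" by (simp add: u_def)
  also have "\<dots> > 0" using s kappa1_pos by simp
  finally have u: "u > 0" by simp
  then have x: "x > 1" by (simp add: x_def)
  then interpret shortcut_spiral \<phi> x using assms by unfold_locales
  have "slope = kappa1"
  proof -
    have "2 * x * (1 - cos \<phi>) = (2 * exp u * sin (\<phi> / 2))\<^sup>2"
      using cos_double_sin[of "\<phi> / 2"] by (simp add: x_def exp_double power_mult_distrib)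
    then have "sqrt (2 * x * (1 - cos \<phi>)) = 2 * exp u * sin (\<phi> / 2)"
      using s by simp
    moreover have "x - 1 = 2 * exp u * sinh u"
    proof -
      have "x = exp u * exp u" by (simp add: x_def flip: exp_add)
      then show ?thesis by (simp add: sinh_def exp_minus right_diff_distrib)
    qed
    ultimately show ?thesis using s by (simp add: slope_def sinh_u)
  qed
  have "2 * u < kappa1 * \<phi>"
  proof -
    have "u \<le> kappa1 * sin (\<phi> / 2)" using le_sinh_real[of u] u by (simp add: sinh_u)
    also have "\<dots> < kappa1 * (\<phi> / 2)"
      using kappa1_pos assms by (intro mult_strict_left_mono sin_less_real) auto
    finally show ?thesis by simp
  qed
  \<comment> \<open>Here \<open>growth = exp (2 * u + kappa1 * (2 * pi - \<phi>))\<close>, so the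
    gain is exactly \<open>kappa1 * \<phi> - 2 * u\<close>.\<close>
  then have "growth < exp (2 * pi * kappa1)"
    unfolding growth_eq \<open>slope = kappa1\<close> unfolding x_def
    by (simp add: right_diff_distrib mult_ac flip: exp_add)
  \<comment> \<open>The prefactor coincides with that of \<open>U1\<close>, hence the comparison
    reduces to the growth per turn.\<close>
  moreover have "chord / (x - 1) = sqrt (1 + kappa1\<^sup>2) / kappa1"
    using chord_slope kappa1_pos by (simp add: \<open>slope = kappa1\<close> field_simps)
  moreover have "sqrt (1 + kappa1\<^sup>2) / kappa1 > 0"
    using kappa1_pos by (simp add: add_pos_nonneg)
  ultimately show ?thesis
    unfolding U1_def using x by (intro exI[of _ x]) (simp only: cost_fun_eq mult_strict_left_mono simp_thms)
qed

theorem theorem4: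
  fixes \<phi> :: real
  assumes "0 < \<phi>" and "\<phi> < pi"
  shows "\<exists>R. is_minimum_on (cost_fun \<phi>) {1<..} R
           \<and> admits_solution_with_cost (conic_complement \<phi>) R
           \<and> R < U1"
proof -
  obtain R where R: "is_minimum_on (cost_fun \<phi>) {1<..} R"
    using cost_fun_attains_minimum[OF assms] by blast
  then obtain l where l: "l > 1" "R = cost_fun \<phi> l" by (auto simp: is_minimum_on_def)
  then interpret shortcut_spiral \<phi> l using assms by unfold_locales
  have "R \<ge> 0" using l chord_pos growth_gt_1 by (simp add: cost_fun_eq)
  then have "admits_solution_with_cost (conic_complement \<phi>) R"
    unfolding admits_solution_with_cost_def using feasible_tau search_cost_tau l by auto
  moreover have "R < U1"
    using exists_cost_less_U1[OF assms] R unfolding is_minimum_on_def by force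
  ultimately show ?thesis using R by blast
qed

end
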